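(* Let $\{(x_k,x_k^* )\}_{k\ge0}$ be generated by the stochastic block Bregman projection (SBBP) method with the decreasing mirror stochastic Polyak stepsize (DecmSPS) $t_k$, under the sampling rule described in the context, and suppose the Bregman distance growth condition holds with constant $\gamma>0$. Then for $\tilde L=\min\left\{\frac{\mu}{2L_{\max}},\frac{\gamma_b}{\lambda_0}\right\}$ and $0<\lambda_k<2$, for every $k\ge0$, $$\mathbb{E}\left[\mathrm{dist}_\psi^{x_{k+1}^*}(x_{k+1},\bar X)^2\right]\le\left[1-\lambda_k\left(1-\frac{\lambda_k}{2}\right)\gamma\tilde L\right]\mathbb{E}\left[\mathrm{dist}_\psi^{x_k^*}(x_k,\bar X)^2\right]+\lambda_k\frac{\gamma_b}{\lambda_0}\sigma_\tau^2.$$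
   Context: Notation: $[m]=\{1,\dots,m\}$; $\|\cdot\|$ is the Euclidean norm. Problem data: $\psi:\mathbb{R}^n\to\mathbb{R}$ is $\mu$-strongly convex ($\mu>0$); each $f_i:\mathbb{R}^n\to\mathbb{R}$, $i\in[m]$, is convex and differentiable with $L_i$-Lipschitz gradient, $L_i>0$; $L_{\max}=\max_{i\in[m]}L_i$; $F(x)=\frac1m\sum_{i=1}^mf_i(x)$; $\bar F=\min_{x\in\mathbb{R}^n}F(x)$ and $\bar X=\arg\min_{x\in\mathbb{R}^n}F(x)$ is nonempty. $\psi^*$ is the Fenchel conjugate of $\psi$ (differentiable with $1/\mu$-Lipschitz gradient). For $x^*\in\partial\psi(x)$, $D_\psi^{x^*}(x,y)=\psi(y)-\psi(x)-\langle x^*,y-x\rangle$ and $\mathrm{dist}_\psi^{x^*}(x,\bar X)^2=\inf_{z\in\bar X}D_\psi^{x^*}(x,z)$. Bregman distance growth condition with constant $\gamma>0$: for every $x\in\mathbb{R}^n$ ($=\mathrm{int}\,\mathrm{dom}\,\psi$) and every $x^*\in\partial\psi(x)$, $F(x)-\bar F\ge\gamma\inf_{z\in\bar X}D_\psi^{x^*}(x,z)$. Sampling rule: fix $\tau\in\{1,\dots,m\}$. At each iteration $k\ge0$ a random subset $J_k\subset[m]$ with $|J_k|=\tau$ is drawn from a fixed distribution with $\mathbf P(i\in J_k)=\tau/m$ for all $i\in[m]$, independently of $J_0,\dots,J_{k-1}$; weights are $w_{i,k}=w_i=1/\tau$, $i\in J_k$. SBBP method: $x_0\in\mathbb{R}^n$,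 $x_0^*\in\partial\psi(x_0)$ and $$x_{k+1}^*=x_k^*-t_k\sum_{i\in J_k}w_{i,k}\nabla f_i(x_k),\qquad x_{k+1}=\nabla\psi^*(x_{k+1}^* ).$$ DecmSPS: for each $J$ let $l_J^*\in\mathbb{R}$ be any lower bound with $l_J^*\le\inf_{x\in\mathbb{R}^n}\sum_{i\in J}w_if_i(x)$. With a nonincreasing positive sequence $\{\lambda_k\}_{k\ge0}$, $\lambda_{-1}=\lambda_0$ and $t_{-1}=\gamma_b>0$, $$t_k=\lambda_k\min\left\{\mu\cdot\frac{\sum_{i\in J_k}w_{i,k}f_i(x_k)-l_{J_k}^*}{\|\sum_{i\in J_k}w_{i,k}\nabla f_i(x_k)\|^2},\ \frac{t_{k-1}}{\lambda_{k-1}}\right\},\quad k\ge0,$$ where the first entry of the minimum is read as $+\infty$ if its denominator is zero. Noise constant: for $\hat x\in\bar X$, $\sigma_\tau^2=\mathbb{E}\left[\sum_{i\in J}w_if_i(\hat x)-l_J^*\right]$, where $J$ has the sampling distribution (the value does not depend on the choice of $\hat x\in\bar X$). *)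

theory Defs
  imports "HOL-Probability.Probability"
begin

definition strongly_convex :: "real \<Rightarrow> ('a::real_inner \<Rightarrow> real) \<Rightarrow> bool" where
  "strongly_convex \<mu> \<psi> \<longleftrightarrow>
     (\<forall>x y. \<forall>u\<in>{0..1}. \<psi> (u *\<^sub>R x + (1 - u) *\<^sub>R y)
        \<le> u * \<psi> x + (1 - u) * \<psi> y - \<mu> / 2 * u * (1 - u) * (norm (x - y))\<^sup>2)"

definition subdifferential :: "('a::real_inner \<Rightarrow> real) \<Rightarrow> 'a \<Rightarrow> 'a set" where
  "subdifferential \<psi> x = {s. \<forall>y. \<psi> y \<ge> \<psi> x + s \<bullet> (y - x)}"

(* Meaningful where f is differentiable; the gradient is then unique. *)
definition grad :: "('a::real_inner \<Rightarrow> real) \<Rightarrow> 'a \<Rightarrow> 'a" where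
  "grad f x = (THE D. GDERIV f x :> D)"

(* The supremum is taken in the reals: it is finite whenever \<psi> is a finite-valued strongly
   convex function on a Euclidean space, the only case in which the conjugate is used. *)
definition fenchel_conjugate :: "('a::real_inner \<Rightarrow> real) \<Rightarrow> 'a \<Rightarrow> real" where
  "fenchel_conjugate \<psi> s = (SUP x. s \<bullet> x - \<psi> x)"

definition bregman :: "('a::real_inner \<Rightarrow> real) \<Rightarrow> 'a \<Rightarrow> 'a \<Rightarrow> 'a \<Rightarrow> real" where
  "bregman \<psi> s x y = \<psi> y - \<psi> x - s \<bullet> (y - x)"

(* The squared distance dist(x, X)^2. For s in the subdifferential at x the Bregman distances are
   nonnegative, so for nonempty X the real infimum is the true one. *)
definition bregman_dist_sq :: "('a::real_inner \<Rightarrow> real) \<Rightarrow> 'a \<Rightarrow> 'a \<Rightarrow> 'a set \<Rightarrow> real" where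
  "bregman_dist_sq \<psi> s x X = (INF z\<in>X. bregman \<psi> s x z)"

definition finite_avg :: "nat \<Rightarrow> (nat \<Rightarrow> 'a \<Rightarrow> real) \<Rightarrow> 'a \<Rightarrow> real" where
  "finite_avg m f x = 1 / real m * (\<Sum>i\<in>{1..m}. f i x)"

definition argmin_set :: "('a \<Rightarrow> real) \<Rightarrow> 'a set" where
  "argmin_set F = {x. is_arg_min F (\<lambda>_. True) x}"

(* A minimum, not just an infimum, whenever argmin_set F is nonempty. *)
definition min_value :: "('a \<Rightarrow> real) \<Rightarrow> real" where
  "min_value F = (INF x. F x)"

definition bregman_growth ::
  "('a::real_inner \<Rightarrow> real) \<Rightarrow> ('a \<Rightarrow> real) \<Rightarrow> real \<Rightarrow> bool" where
  "bregman_growth \<psi> F \<gamma> \<longleftrightarrow>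
     (\<forall>x. \<forall>s\<in>subdifferential \<psi> x.
        F x - min_value F \<ge> \<gamma> * (INF z\<in>argmin_set F. bregman \<psi> s x z))"

(* Block value and block gradient with the weights w_i = 1/\<tau>. *)
definition block_val :: "nat \<Rightarrow> (nat \<Rightarrow> 'a \<Rightarrow> real) \<Rightarrow> nat set \<Rightarrow> 'a \<Rightarrow> real" where
  "block_val \<tau> f S x = (\<Sum>i\<in>S. 1 / real \<tau> * f i x)"

definition block_grad ::
  "nat \<Rightarrow> (nat \<Rightarrow> 'a::real_inner \<Rightarrow> real) \<Rightarrow> nat set \<Rightarrow> 'a \<Rightarrow> 'a" where
  "block_grad \<tau> f S x = (\<Sum>i\<in>S. (1 / real \<tau>) *\<^sub>R grad (f i) x)"

(* J 0, J 1, ... are random \<tau>-element subsets of {1..m}, independent, with common law D,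
   under which every index has inclusion probability \<tau>/m. *)
definition block_sampling ::
  "'w measure \<Rightarrow> nat \<Rightarrow> nat \<Rightarrow> nat set pmf \<Rightarrow> (nat \<Rightarrow> 'w \<Rightarrow> nat set) \<Rightarrow> bool" where
  "block_sampling M m \<tau> D J \<longleftrightarrow>
     prob_space M \<and>
     (\<forall>k. \<forall>\<omega>\<in>space M. J k \<omega> \<subseteq> {1..m} \<and> card (J k \<omega>) = \<tau>) \<and>
     prob_space.indep_vars M (\<lambda>_. count_space UNIV) J UNIV \<and>
     (\<forall>k. distr M (count_space UNIV) (J k) = measure_pmf D) \<and>
     (\<forall>i\<in>{1..m}. measure_pmf.prob D {S. i \<in> S} = real \<tau> / real m)"

(* One trajectory of the method, for given blocks Js and stepsizes ts. *)
definition sbbp ::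
  "('a::real_inner \<Rightarrow> real) \<Rightarrow> (nat \<Rightarrow> 'a \<Rightarrow> real) \<Rightarrow> nat \<Rightarrow> 'a \<Rightarrow> 'a \<Rightarrow>
   (nat \<Rightarrow> nat set) \<Rightarrow> (nat \<Rightarrow> real) \<Rightarrow> (nat \<Rightarrow> 'a) \<Rightarrow> (nat \<Rightarrow> 'a) \<Rightarrow> bool" where
  "sbbp \<psi> f \<tau> x0 s0 Js ts xs ss \<longleftrightarrow>
     s0 \<in> subdifferential \<psi> x0 \<and> xs 0 = x0 \<and> ss 0 = s0 \<and>
     (\<forall>k. ss (Suc k) = ss k - ts k *\<^sub>R block_grad \<tau> f (Js k) (xs k) \<and>
          xs (Suc k) = grad (fenchel_conjugate \<psi>) (ss (Suc k)))"

(* The ratio t_(k-1) / \<lambda>_(k-1), with the conventions t_(-1) = \<gamma>\<^sub>b and \<lambda>_(-1) = \<lambda>_0. *)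
definition prev_ratio :: "(nat \<Rightarrow> real) \<Rightarrow> real \<Rightarrow> (nat \<Rightarrow> real) \<Rightarrow> nat \<Rightarrow> real" where
  "prev_ratio lam \<gamma>\<^sub>b ts k = (case k of 0 \<Rightarrow> \<gamma>\<^sub>b / lam 0 | Suc j \<Rightarrow> ts j / lam j)"

(* If the block gradient vanishes, the first entry of the minimum is +\<infinity>, so the minimum is
   the second entry. *)
definition decmsps ::
  "real \<Rightarrow> (nat \<Rightarrow> 'a::real_inner \<Rightarrow> real) \<Rightarrow> nat \<Rightarrow> (nat set \<Rightarrow> real) \<Rightarrow> (nat \<Rightarrow> real) \<Rightarrow> real \<Rightarrow>
   (nat \<Rightarrow> nat set) \<Rightarrow> (nat \<Rightarrow> 'a) \<Rightarrow> (nat \<Rightarrow> real) \<Rightarrow> bool" where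
  "decmsps \<mu> f \<tau> l lam \<gamma>\<^sub>b Js xs ts \<longleftrightarrow>
     (\<forall>k. ts k = lam k *
        (if (norm (block_grad \<tau> f (Js k) (xs k)))\<^sup>2 = 0 then prev_ratio lam \<gamma>\<^sub>b ts k
         else min (\<mu> * ((block_val \<tau> f (Js k) (xs k) - l (Js k))
                        / (norm (block_grad \<tau> f (Js k) (xs k)))\<^sup>2))
                  (prev_ratio lam \<gamma>\<^sub>b ts k)))"

definition noise_const ::
  "nat \<Rightarrow> (nat \<Rightarrow> 'a \<Rightarrow> real) \<Rightarrow> (nat set \<Rightarrow> real) \<Rightarrow> nat set pmf \<Rightarrow> 'a \<Rightarrow> real" where
  "noise_const \<tau> f l D z = measure_pmf.expectation D (\<lambda>S. block_val \<tau> f S z - l S)"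

end

theory Submission
  imports Defs
begin

text \<open>The three-point identity and strong convexity bound the Bregman distance after one step by
  the old one plus \<open>- t \<langle>g, x - z\<rangle> + t\<^sup>2 \<parallel>g\<parallel>\<^sup>2 / (2 \<mu>)\<close>. The Polyak cap on \<open>t / \<lambda>\<close> turns the quadratic
  term into \<open>t \<lambda> / 2\<close> times the gap between the block value and its lower bound, while \<open>L_max\<close>-smoothness keeps
  \<open>t / \<lambda>\<close> above \<open>min (\<mu> / (2 L_max)) (\<gamma>\<^sub>b / \<lambda>\<^sub>0)\<close>. The current state depends only on the earlier blocks
  and takes finitely many values, so the new block can be averaged for each fixed state; the infimum
  over minimisers is taken after this averaging, and the growth condition concludes.\<close>

section \<open>Gradients, the gradient inequality and the descent lemma\<close>

lemma GDERIV_unique: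
  assumes "GDERIV f x :> D" and "GDERIV f x :> E"
  shows "D = E"
proof -
  have "(\<lambda>h. h \<bullet> D) = (\<lambda>h. h \<bullet> E)"
    using assms unfolding gderiv_def by (rule has_derivative_unique)
  then have "(D - E) \<bullet> D = (D - E) \<bullet> E"
    by (rule fun_cong)
  then have "(D - E) \<bullet> (D - E) = 0"
    by (simp add: inner_diff_right)
  then show ?thesis
    by simp
qed

lemma grad_eqI: "GDERIV f x :> D \<Longrightarrow> grad f x = D"
  unfolding grad_def by (rule the_equality) (auto intro: GDERIV_unique)

text \<open>The derivative is a linear functional, and in finite dimension its adjoint at 1 is the
  vector that represents it.\<close>

lemma GDERIV_grad:
  fixes f :: "'a::euclidean_space \<Rightarrow> real"
  assumes "f differentiable (at x)"
  shows "GDERIV f x :> grad f x"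
proof -
  obtain f' where f': "(f has_derivative f') (at x)"
    using assms unfolding differentiable_def by blast
  then have lin: "linear f'"
    by (rule has_derivative_linear)
  have "f' = (\<lambda>h. h \<bullet> adjoint f' 1)"
    by (rule ext) (simp add: adjoint_works[OF lin])
  then have "GDERIV f x :> adjoint f' 1"
    using f' unfolding gderiv_def by simp
  then show ?thesis
    using grad_eqI by metis
qed

lemma GDERIV_along_line:
  assumes "GDERIV f (x + u *\<^sub>R d) :> D"
  shows "((\<lambda>u. f (x + u *\<^sub>R d)) has_real_derivative D \<bullet> d) (at u)"
proof -
  have "((\<lambda>u. x + u *\<^sub>R d) has_derivative (\<lambda>h. h *\<^sub>R d)) (at u)"
    by (auto intro!: derivative_eq_intros)
  from has_derivative_compose[OF this assms[unfolded gderiv_def]]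
  show ?thesis
    unfolding has_field_derivative_def
    by (rule has_derivative_subst) (auto simp: inner_commute mult.commute)
qed

text \<open>Restriction to the line through \<open>x\<close> and \<open>y\<close> reduces this to
  the tangent inequality for a convex function of one real variable at 0.\<close>

lemma convex_on_above_gradient:
  assumes cvx: "convex_on UNIV f" and D: "GDERIV f x :> D"
  shows "f y \<ge> f x + D \<bullet> (y - x)"
proof -
  let ?\<phi> = "\<lambda>u. f (x + u *\<^sub>R (y - x))"
  have "convex_on UNIV ?\<phi>"
  proof (rule convex_onI)
    fix t u v :: real
    assume "0 < t" "t < 1"
    moreover have "x + ((1 - t) *\<^sub>R u + t *\<^sub>R v) *\<^sub>R (y - x)
        = (1 - t) *\<^sub>R (x + u *\<^sub>R (y - x)) + t *\<^sub>R (x + v *\<^sub>R (y - x))"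
      by (simp add: algebra_simps)
    ultimately show "?\<phi> ((1 - t) *\<^sub>R u + t *\<^sub>R v) \<le> (1 - t) * ?\<phi> u + t * ?\<phi> v"
      using convex_onD[OF cvx, of t] by simp
  qed simp
  then have "?\<phi> 1 - ?\<phi> 0 \<ge> (D \<bullet> (y - x)) * (1 - 0)"
    by (rule convex_on_imp_above_tangent)
       (use D in \<open>auto intro!: GDERIV_along_line\<close>)
  then show ?thesis
    by simp
qed

text \<open>Along the segment, the linear and quadratic terms are subtracted from \<open>f\<close>;
  Cauchy-Schwarz and the Lipschitz bound make the derivative of the difference nonpositive, which
  replaces the usual integral.\<close>

lemma descent_lemma:
  fixes f :: "'a::real_inner \<Rightarrow> real"
  assumes D: "\<And>x. GDERIV f x :> g x" and lip: "L-lipschitz_on UNIV g"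
  shows "f y \<le> f x + g x \<bullet> (y - x) + L / 2 * (norm (y - x))\<^sup>2"
proof -
  define d where "d = y - x"
  let ?\<phi> = "\<lambda>u. f (x + u *\<^sub>R d) - u * (g x \<bullet> d) - L / 2 * u\<^sup>2 * (norm d)\<^sup>2"
  have "?\<phi> 0 \<ge> ?\<phi> 1"
  proof (rule DERIV_nonpos_imp_nonincreasing[of 0 1])
    fix u :: real
    assume u: "0 \<le> u" "u \<le> 1"
    have "(?\<phi> has_real_derivative g (x + u *\<^sub>R d) \<bullet> d - g x \<bullet> d - L * u * (norm d)\<^sup>2) (at u)"
      by (rule derivative_eq_intros GDERIV_along_line D refl)+ simp
    moreover have "g (x + u *\<^sub>R d) \<bullet> d - g x \<bullet> d \<le> norm (g (x + u *\<^sub>R d) - g x) * norm d"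
      by (metis inner_diff_left norm_cauchy_schwarz)
    moreover have "norm (g (x + u *\<^sub>R d) - g x) \<le> L * (u * norm d)"
      using lipschitz_onD[OF lip, of "x + u *\<^sub>R d" x] u by (simp add: dist_norm)
    then have "norm (g (x + u *\<^sub>R d) - g x) * norm d \<le> L * (u * norm d) * norm d"
      by (rule mult_right_mono) simp
    ultimately show "\<exists>z. (?\<phi> has_real_derivative z) (at u) \<and> z \<le> 0"
      by (intro exI[of _ "g (x + u *\<^sub>R d) \<bullet> d - g x \<bullet> d - L * u * (norm d)\<^sup>2"] conjI)
        (simp_all add: power2_eq_square algebra_simps)
  qed simp
  then show ?thesis
    by (simp add: d_def)
qed

section \<open>Strong convexity, subgradients and the Fenchel conjugate\<close>

lemma strongly_convex_imp_convex_on: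
  assumes "strongly_convex \<mu> \<psi>" and "\<mu> \<ge> 0"
  shows "convex_on UNIV \<psi>"
proof (rule convex_onI)
  fix t :: real and x y
  assume t: "0 < t" "t < 1"
  then have "\<psi> (t *\<^sub>R y + (1 - t) *\<^sub>R x)
      \<le> t * \<psi> y + (1 - t) * \<psi> x - \<mu> / 2 * t * (1 - t) * (norm (y - x))\<^sup>2"
    using assms unfolding strongly_convex_def by simp
  moreover have "0 \<le> \<mu> / 2 * t * (1 - t) * (norm (y - x))\<^sup>2"
    using t assms(2) by simp
  ultimately show "\<psi> ((1 - t) *\<^sub>R x + t *\<^sub>R y) \<le> (1 - t) * \<psi> x + t * \<psi> y"
    by (simp add: add.commute)
qed simp

text \<open>At \<open>x + u (y - x)\<close>, strong convexity bounds \<psi> from above and the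
  subgradient from below; dividing by \<open>u\<close> and letting \<open>u\<close> tend to 0 gives
  the claim.\<close>

lemma strongly_convex_subgradient_ge:
  assumes sc: "strongly_convex \<mu> \<psi>" and s: "s \<in> subdifferential \<psi> x"
  shows "\<psi> y \<ge> \<psi> x + s \<bullet> (y - x) + \<mu> / 2 * (norm (y - x))\<^sup>2"
proof -
  have "\<mu> / 2 * (norm (y - x))\<^sup>2 \<le> \<psi> y - \<psi> x - s \<bullet> (y - x)"
  proof (rule field_le_mult_one_interval)
    fix z :: real
    assume z: "0 < z" "z < 1"
    \<comment> \<open>The limit is replaced by a comparison for every factor \<open>z\<close> below
      1; the factor \<open>1 - u\<close> of the quadratic term plays this role.\<close>
    define u where "u = 1 - z"
    have u: "0 < u" "u < 1"
      using z by (auto simp: u_def)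
    have "\<psi> (u *\<^sub>R y + (1 - u) *\<^sub>R x)
        \<le> u * \<psi> y + (1 - u) * \<psi> x - \<mu> / 2 * u * (1 - u) * (norm (y - x))\<^sup>2"
      using sc u unfolding strongly_convex_def by simp
    moreover have "u *\<^sub>R y + (1 - u) *\<^sub>R x = x + u *\<^sub>R (y - x)"
      by (simp add: algebra_simps)
    moreover have "\<psi> (x + u *\<^sub>R (y - x)) \<ge> \<psi> x + s \<bullet> (x + u *\<^sub>R (y - x) - x)"
      using s unfolding subdifferential_def by blast
    ultimately have "u * (z * (\<mu> / 2 * (norm (y - x))\<^sup>2)) \<le> u * (\<psi> y - \<psi> x - s \<bullet> (y - x))"
      by (simp add: u_def algebra_simps)
    then show "z * (\<mu> / 2 * (norm (y - x))\<^sup>2) \<le> \<psi> y - \<psi> x - s \<bullet> (y - x)"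
      using u by simp
  qed
  then show ?thesis
    by simp
qed

text \<open>Young's inequality, weighted so that its last term cancels the quadratic gain from
  strong convexity, both for the conjugate and in the mirror step.\<close>

lemma inner_le_young:
  fixes a b :: "'a::real_inner"
  assumes "\<mu> > 0"
  shows "a \<bullet> b \<le> (norm a)\<^sup>2 / (2 * \<mu>) + \<mu> / 2 * (norm b)\<^sup>2"
proof -
  have "0 \<le> (norm (a - \<mu> *\<^sub>R b))\<^sup>2"
    by simp
  also have "\<dots> = (norm a)\<^sup>2 - 2 * \<mu> * (a \<bullet> b) + \<mu>\<^sup>2 * (norm b)\<^sup>2"
    unfolding power2_norm_eq_inner
    by (simp add: inner_diff_left inner_diff_right inner_commute power2_eq_square algebra_simps)
  finally show ?thesis
    using assms by (simp add: field_simps power2_eq_square)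
qed

text \<open>A subgradient at one point makes \<open>\<psi> - s\<close> coercive, so its minimum is attained.\<close>

lemma strongly_convex_subgradient_surj:
  fixes \<psi> :: "'a::euclidean_space \<Rightarrow> real"
  assumes "\<mu> > 0" and sc: "strongly_convex \<mu> \<psi>" and s0: "s0 \<in> subdifferential \<psi> x0"
  obtains x where "s \<in> subdifferential \<psi> x"
proof -
  define h where "h y = \<psi> y - s \<bullet> y" for y
  \<comment> \<open>At distance \<open>R\<close> from \<open>x0\<close> the quadratic term \<mu>/2
    r^2 catches up with the linear term \<open>norm (s - s0) * r\<close>. Outside the ball
    \<open>h\<close> is therefore at least \<open>h x0\<close>, and a minimiser over the ball is
    global.\<close>
  define R where "R = 2 * norm (s - s0) / \<mu>"
  have "R \<ge> 0"
    using \<open>\<mu> > 0\<close> by (simp add: R_def)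
  have "continuous_on UNIV \<psi>"
    using strongly_convex_imp_convex_on[OF sc] \<open>\<mu> > 0\<close> by (intro convex_on_continuous) auto
  then have "continuous_on (cball x0 R) h"
    unfolding h_def by (intro continuous_intros) (auto intro: continuous_on_subset)
  then obtain x where x: "\<And>y. y \<in> cball x0 R \<Longrightarrow> h x \<le> h y"
    using continuous_attains_inf[OF compact_cball, of x0 R h] \<open>R \<ge> 0\<close>
    by (metis cball_eq_empty linorder_not_less)
  have "h x \<le> h y" for y
  proof (cases "y \<in> cball x0 R")
    case False
    let ?r = "norm (y - x0)"
    have r: "R < ?r"
      using False by (simp add: dist_norm norm_minus_commute)
    have "(s - s0) \<bullet> (y - x0) \<le> norm (s - s0) * ?r"
      by (rule norm_cauchy_schwarz)
    also have "norm (s - s0) = \<mu> / 2 * R"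
      using \<open>\<mu> > 0\<close> by (simp add: R_def)
    also have "\<mu> / 2 * R * ?r \<le> \<mu> / 2 * ?r * ?r"
      using r \<open>\<mu> > 0\<close> by (intro mult_right_mono mult_left_mono) auto
    finally have "(s - s0) \<bullet> (y - x0) \<le> \<mu> / 2 * ?r\<^sup>2"
      by (simp add: power2_eq_square)
    then have "h x0 \<le> h y"
      using strongly_convex_subgradient_ge[OF sc s0, of y]
      by (simp add: h_def inner_diff_left inner_diff_right)
    moreover have "h x \<le> h x0"
      using \<open>R \<ge> 0\<close> by (intro x) simp
    ultimately show ?thesis
      by simp
  qed (rule x)
  then have "s \<in> subdifferential \<psi> x"
    by (auto simp: subdifferential_def h_def inner_diff_right algebra_simps)
  then show thesis ..
qed

text \<open>The subgradient inequality says that \<open>x\<close> attains the supremum, so this is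
  the equality case of Fenchel-Young.\<close>

lemma fenchel_conjugate_eq:
  assumes "s \<in> subdifferential \<psi> x"
  shows "fenchel_conjugate \<psi> s = s \<bullet> x - \<psi> x"
  unfolding fenchel_conjugate_def
proof (rule cSup_eq_maximum)
  show "z \<le> s \<bullet> x - \<psi> x" if "z \<in> range (\<lambda>y. s \<bullet> y - \<psi> y)" for z
    using that assms by (auto simp: subdifferential_def inner_diff_right algebra_simps)
qed simp

text \<open>The first-order remainder at \<open>s'\<close> equals the Bregman distance from
  \<open>y\<close> to \<open>x\<close>, where \<open>s'\<close> is a subgradient at
  \<open>y\<close>. It is thus nonnegative, and strong convexity with Young's inequality makes it
  quadratically small.\<close>

lemma GDERIV_fenchel_conjugate:
  fixes \<psi> :: "'a::euclidean_space \<Rightarrow> real"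
  assumes "\<mu> > 0" and sc: "strongly_convex \<mu> \<psi>" and s: "s \<in> subdifferential \<psi> x"
  shows "GDERIV (fenchel_conjugate \<psi>) s :> x"
proof -
  define r where "r s' = fenchel_conjugate \<psi> s' - fenchel_conjugate \<psi> s - (s' - s) \<bullet> x" for s'
  have bound: "\<bar>r s'\<bar> \<le> (norm (s' - s))\<^sup>2 / (2 * \<mu>)" for s'
  proof -
    obtain y where y: "s' \<in> subdifferential \<psi> y"
      by (rule strongly_convex_subgradient_surj[OF \<open>\<mu> > 0\<close> sc s])
    have "\<psi> x \<ge> \<psi> y + s' \<bullet> (x - y)"
      using y by (simp add: subdifferential_def)
    moreover have "\<psi> y \<ge> \<psi> x + s \<bullet> (y - x) + \<mu> / 2 * (norm (y - x))\<^sup>2"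
      by (rule strongly_convex_subgradient_ge[OF sc s])
    moreover have "(s' - s) \<bullet> (y - x) \<le> (norm (s' - s))\<^sup>2 / (2 * \<mu>) + \<mu> / 2 * (norm (y - x))\<^sup>2"
      by (rule inner_le_young[OF \<open>\<mu> > 0\<close>])
    ultimately show ?thesis
      unfolding r_def fenchel_conjugate_eq[OF s] fenchel_conjugate_eq[OF y]
      by (simp add: inner_diff_left inner_diff_right)
  qed
  have "((\<lambda>s'. r s' / norm (s' - s)) \<longlongrightarrow> 0) (at s)"
  proof (rule Lim_null_comparison)
    show "\<forall>\<^sub>F s' in at s. norm (r s' / norm (s' - s)) \<le> norm (s' - s) / (2 * \<mu>)"
      using bound by (intro always_eventually allI)
        (auto simp: divide_simps power2_eq_square abs_mult)
    show "((\<lambda>s'. norm (s' - s) / (2 * \<mu>)) \<longlongrightarrow> 0) (at s)"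
      using \<open>\<mu> > 0\<close> by (auto intro!: tendsto_eq_intros)
  qed
  then show ?thesis
    unfolding gderiv_def has_derivative_at_within r_def
    by (auto simp: bounded_linear_inner_left inverse_eq_divide)
qed

text \<open>Some point has \<open>s\<close> as a subgradient, and the gradient of the conjugate at
  \<open>s\<close> is that point. This keeps every dual iterate a subgradient at its primal
  iterate.\<close>

lemma grad_fenchel_conjugate_subdifferential:
  fixes \<psi> :: "'a::euclidean_space \<Rightarrow> real"
  assumes "\<mu> > 0" and "strongly_convex \<mu> \<psi>" and "s0 \<in> subdifferential \<psi> x0"
  shows "s \<in> subdifferential \<psi> (grad (fenchel_conjugate \<psi>) s)"
  using assms GDERIV_fenchel_conjugate grad_eqI strongly_convex_subgradient_surj by metis

section \<open>Bregman distances and the mirror step\<close>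

lemma bregman_nonneg: "s \<in> subdifferential \<psi> x \<Longrightarrow> 0 \<le> bregman \<psi> s x z"
  by (auto simp: subdifferential_def bregman_def diff_diff_eq)

lemma bregman_dist_sq_le:
  assumes "s \<in> subdifferential \<psi> x" and "z \<in> X"
  shows "bregman_dist_sq \<psi> s x X \<le> bregman \<psi> s x z"
  unfolding bregman_dist_sq_def
  using assms(2) bregman_nonneg[OF assms(1)] by (auto intro!: cINF_lower bdd_belowI)

text \<open>Three-point identity, with \<open>s - s'\<close> paired against \<open>x - x'\<close> by Young's inequality.\<close>

lemma bregman_mirror_step:
  assumes "\<mu> > 0" and sc: "strongly_convex \<mu> \<psi>" and s: "s \<in> subdifferential \<psi> x"
  shows "bregman \<psi> (s - t *\<^sub>R g) x' z
    \<le> bregman \<psi> s x z - t * (g \<bullet> (x - z)) + t\<^sup>2 * (norm g)\<^sup>2 / (2 * \<mu>)"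
proof -
  have "bregman \<psi> (s - t *\<^sub>R g) x' z
      = bregman \<psi> s x z - bregman \<psi> s x x' - t * (g \<bullet> (x - z)) + (t *\<^sub>R g) \<bullet> (x - x')"
    by (simp add: bregman_def inner_diff_left inner_diff_right algebra_simps)
  \<comment> \<open>This term enters the identity with a negative sign and absorbs the quadratic in
    \<open>x - x'\<close> that Young's inequality creates.\<close>
  moreover have "bregman \<psi> s x x' \<ge> \<mu> / 2 * (norm (x - x'))\<^sup>2"
    using strongly_convex_subgradient_ge[OF sc s, of x']
    by (simp add: bregman_def norm_minus_commute)
  moreover have "(t *\<^sub>R g) \<bullet> (x - x') \<le> (norm (t *\<^sub>R g))\<^sup>2 / (2 * \<mu>) + \<mu> / 2 * (norm (x - x'))\<^sup>2"
    by (rule inner_le_young[OF \<open>\<mu> > 0\<close>])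
  ultimately show ?thesis
    by (simp add: power_mult_distrib)
qed

section \<open>Independence of the past and averaging over a fresh block\<close>

text \<open>By \<open>past\<close>, \<open>X\<close> is a function of the first \<open>k\<close>
  blocks. With finitely many possible blocks there are finitely many pasts, so every such function
  is measurable, takes finitely many values and inherits independence from block
  \<open>k\<close>.\<close>

lemma (in prob_space) past_of_blocks:
  assumes ind: "indep_vars (\<lambda>_. count_space UNIV) J (UNIV :: nat set)"
    and fin: "finite \<S>" and J: "\<And>j \<omega>. \<omega> \<in> space M \<Longrightarrow> J j \<omega> \<in> \<S>"
    and past: "\<And>\<omega> \<omega>'. \<omega> \<in> space M \<Longrightarrow> \<omega>' \<in> space M \<Longrightarrow> (\<And>j. j < k \<Longrightarrow> J j \<omega> = J j \<omega>') \<Longrightarrow> X \<omega> = X \<omega>'"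
  shows prob_past_block: "prob (X -` A \<inter> space M \<inter> (J k -` B \<inter> space M))
      = prob (X -` A \<inter> space M) * prob (J k -` B \<inter> space M)"
    and measurable_past: "X \<in> measurable M (count_space UNIV)"
    and finite_range_past: "finite (X ` space M)"
proof -
  \<comment> \<open>Over the finite \<open>\<S>\<close> the product spaces are discrete, so no
    measurability question arises for functions of the past.\<close>
  have ind': "indep_vars (\<lambda>_. count_space \<S>) J UNIV"
    unfolding indep_vars_def2
  proof (intro conjI ballI)
    show "random_variable (count_space \<S>) (J j)" for j
      using ind J by (auto simp: indep_vars_def2 measurable_def)
    show "indep_sets (\<lambda>j. {J j -` A \<inter> space M |A. A \<in> sets (count_space \<S>)}) UNIV"
      by (rule indep_sets_mono_sets[OF conjunct2[OF ind[unfolded indep_vars_def2]]]) auto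
  qed
  define P where "P \<omega> = restrict (\<lambda>j. J j \<omega>) {..<k}" for \<omega>
  \<comment> \<open>An arbitrary outcome with past \<open>p\<close> is chosen; by
    \<open>past\<close> the value of \<open>X\<close> does not depend on the choice.\<close>
  define \<phi> where "\<phi> p = X (SOME \<omega>. \<omega> \<in> space M \<and> P \<omega> = p)" for p
  have \<phi>: "X \<omega> = \<phi> (P \<omega>)" if "\<omega> \<in> space M" for \<omega>
  proof -
    let ?\<omega>' = "SOME \<omega>'. \<omega>' \<in> space M \<and> P \<omega>' = P \<omega>"
    have "?\<omega>' \<in> space M \<and> P ?\<omega>' = P \<omega>"
      by (rule someI) (use that in auto)
    then have "J j \<omega> = J j ?\<omega>'" if "j < k" for j
      using that unfolding P_def by (auto dest: fun_cong[of _ _ j])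
    then show ?thesis
      unfolding \<phi>_def using \<open>?\<omega>' \<in> space M \<and> _\<close> that by (intro past) auto
  qed
  have "X ` space M \<subseteq> \<phi> ` ({..<k} \<rightarrow>\<^sub>E \<S>)"
    using \<phi> J by (fastforce simp: P_def)
  then show "finite (X ` space M)"
    by (rule finite_subset) (auto intro: finite_PiE fin)
  have iv: "indep_var (PiM {..<k} (\<lambda>_. count_space \<S>)) P
      (PiM {k} (\<lambda>_. count_space \<S>)) (\<lambda>\<omega>. restrict (\<lambda>j. J j \<omega>) {k})"
    unfolding P_def by (rule indep_var_restrict[OF ind']) auto
  note PiM_eq = count_space_PiM_finite[OF _ countable_finite[OF fin]]
  let ?K = "({..<k} \<rightarrow>\<^sub>E \<S>)"
  have P: "P \<omega> \<in> ?K" if "\<omega> \<in> space M" for \<omega>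
    using that J by (auto simp: P_def)
  have X_vimage: "X -` A \<inter> space M = P -` (?K \<inter> \<phi> -` A) \<inter> space M" for A
    using \<phi> P by auto
  have J_vimage: "J k -` B \<inter> space M
      = (\<lambda>\<omega>. restrict (\<lambda>j. J j \<omega>) {k}) -` (({k} \<rightarrow>\<^sub>E \<S>) \<inter> (\<lambda>p. p k) -` B) \<inter> space M"
    using J by auto
  show "prob (X -` A \<inter> space M \<inter> (J k -` B \<inter> space M))
      = prob (X -` A \<inter> space M) * prob (J k -` B \<inter> space M)"
    unfolding X_vimage J_vimage
    by (subst indep_varD[OF iv, symmetric]) (auto simp: PiM_eq intro!: arg_cong[where f = prob])
  have "P \<in> measurable M (count_space ?K)"
    using indep_var_rv1[OF iv] by (simp add: PiM_eq)
  then have "P -` (?K \<inter> \<phi> -` A) \<inter> space M \<in> events" for A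
    by (rule measurable_sets) auto
  then show "X \<in> measurable M (count_space UNIV)"
    unfolding X_vimage[symmetric] by (intro measurableI) simp_all
qed

text \<open>Fubini for finitely many values: the expectation is a double sum over the events
  \<open>A a \<inter> B b\<close>, whose probabilities factor. It averages the new block while the
  state is frozen.\<close>

lemma (in prob_space) expectation_indep_pmf:
  fixes u :: "'b \<Rightarrow> 'c \<Rightarrow> real"
  assumes X: "X \<in> measurable M (count_space UNIV)" and Y: "Y \<in> measurable M (count_space UNIV)"
    and ind: "\<And>a b. prob (X -` {a} \<inter> space M \<inter> (Y -` {b} \<inter> space M))
        = prob (X -` {a} \<inter> space M) * prob (Y -` {b} \<inter> space M)"
    and finX: "finite (X ` space M)" and finY: "finite (Y ` space M)"
    and D: "distr M (count_space UNIV) Y = measure_pmf D"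
  shows "expectation (\<lambda>\<omega>. u (X \<omega>) (Y \<omega>))
    = expectation (\<lambda>\<omega>. measure_pmf.expectation D (u (X \<omega>)))"
proof -
  define A where "A a = X -` {a} \<inter> space M" for a
  define B where "B b = Y -` {b} \<inter> space M" for b
  have A [simp]: "A a \<in> sets M" for a
    using measurable_sets[OF X] by (simp add: A_def)
  have B [simp]: "B b \<in> sets M" for b
    using measurable_sets[OF Y] by (simp add: B_def)
  have pmf_Y: "pmf D b = prob (B b)" for b
    using measure_distr[OF Y, of "{b}"] by (simp add: D measure_pmf_single B_def)
  have [simp]: "A a \<inter> B b \<in> events" for a b
    by (intro sets.Int A B)
  have [simp]: "integrable M (indicat_real C)" if "C \<in> events" for C
    using that by (intro integrable_real_indicator) (auto simp: emeasure_eq_measure)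
  have AB: "prob (A a \<inter> B b) = prob (A a) * prob (B b)" for a b
    using ind by (simp add: A_def B_def)
  \<comment> \<open>Points of positive mass are values of \<open>Y\<close>, so an expectation under
    \<open>D\<close> is a finite sum over the range of \<open>Y\<close>.\<close>
  have supp: "set_pmf D \<subseteq> Y ` space M"
  proof
    fix b assume "b \<in> set_pmf D"
    then have "prob (B b) \<noteq> 0"
      by (simp add: set_pmf_iff pmf_Y)
    then have "B b \<noteq> {}"
      by auto
    then show "b \<in> Y ` space M"
      by (auto simp: B_def)
  qed
  have ED: "measure_pmf.expectation D (u a) = (\<Sum>b\<in>Y ` space M. prob (B b) * u a b)" for a
    by (subst integral_measure_pmf[OF finY]) (use supp in \<open>auto simp: pmf_Y\<close>)
  have "expectation (\<lambda>\<omega>. u (X \<omega>) (Y \<omega>))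
      = expectation (\<lambda>\<omega>. \<Sum>a\<in>X ` space M. \<Sum>b\<in>Y ` space M. u a b * indicator (A a \<inter> B b) \<omega>)"
  proof (rule Bochner_Integration.integral_cong[OF refl])
    fix \<omega> assume \<omega>: "\<omega> \<in> space M"
    have "(\<Sum>a\<in>X ` space M. \<Sum>b\<in>Y ` space M. u a b * indicator (A a \<inter> B b) \<omega>)
        = (\<Sum>a\<in>X ` space M. \<Sum>b\<in>Y ` space M. if b = Y \<omega> then if a = X \<omega> then u a b else 0 else 0)"
      using \<omega> by (intro sum.cong) (auto simp: indicator_def A_def B_def)
    also have "\<dots> = u (X \<omega>) (Y \<omega>)"
      using \<omega> by (simp add: sum.delta finX finY)
    finally show "u (X \<omega>) (Y \<omega>)
        = (\<Sum>a\<in>X ` space M. \<Sum>b\<in>Y ` space M. u a b * indicator (A a \<inter> B b) \<omega>)" ..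
  qed
  also have "\<dots> = (\<Sum>a\<in>X ` space M. \<Sum>b\<in>Y ` space M. u a b * (prob (A a) * prob (B b)))"
    by (simp add: Bochner_Integration.integral_sum AB)
  also have "\<dots> = (\<Sum>a\<in>X ` space M. measure_pmf.expectation D (u a) * prob (A a))"
    by (simp add: ED sum_distrib_left sum_distrib_right ac_simps)
  also have "\<dots> = expectation (\<lambda>\<omega>. \<Sum>a\<in>X ` space M. measure_pmf.expectation D (u a) * indicator (A a) \<omega>)"
    by (simp add: Bochner_Integration.integral_sum)
  also have "\<dots> = expectation (\<lambda>\<omega>. measure_pmf.expectation D (u (X \<omega>)))"
  proof (rule Bochner_Integration.integral_cong[OF refl])
    fix \<omega> assume \<omega>: "\<omega> \<in> space M"
    have "(\<Sum>a\<in>X ` space M. measure_pmf.expectation D (u a) * indicator (A a) \<omega>)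
        = (\<Sum>a\<in>X ` space M. if a = X \<omega> then measure_pmf.expectation D (u a) else 0)"
      using \<omega> by (intro sum.cong) (auto simp: indicator_def A_def)
    then show "(\<Sum>a\<in>X ` space M. measure_pmf.expectation D (u a) * indicator (A a) \<omega>)
        = measure_pmf.expectation D (u (X \<omega>))"
      using \<omega> by (simp add: sum.delta finX)
  qed
  finally show ?thesis .
qed

lemma (in prob_space) integrable_finite_range:
  fixes u :: "'b \<Rightarrow> real"
  assumes "X \<in> measurable M (count_space UNIV)" and "finite (X ` space M)"
  shows "integrable M (\<lambda>\<omega>. u (X \<omega>))"
proof -
  have "simple_function M X"
    using assms measurable_sets[OF assms(1)] by (auto simp: simple_function_def)
  then have "simple_function M (\<lambda>\<omega>. u (X \<omega>))"
    by (rule simple_function_compose1)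
  then show ?thesis
    by (rule integrable_simple_function) (simp add: emeasure_eq_measure)
qed

section \<open>Convexity and smoothness of block averages\<close>

locale smooth_blocks =
  fixes f :: "nat \<Rightarrow> 'a::euclidean_space \<Rightarrow> real" and L :: "nat \<Rightarrow> real" and m \<tau> :: nat
  assumes convex: "i \<in> {1..m} \<Longrightarrow> convex_on UNIV (f i)"
    and differentiable: "i \<in> {1..m} \<Longrightarrow> f i differentiable_on UNIV"
    and L_pos: "i \<in> {1..m} \<Longrightarrow> L i > 0"
    and lipschitz: "i \<in> {1..m} \<Longrightarrow> (L i)-lipschitz_on UNIV (grad (f i))"
    and block_size: "\<tau> \<in> {1..m}"
begin

definition L_max :: real where "L_max = Max (L ` {1..m})"

definition blocks :: "nat set set" where "blocks = {S. S \<subseteq> {1..m} \<and> card S = \<tau>}"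

lemma L_le_L_max: "i \<in> {1..m} \<Longrightarrow> L i \<le> L_max"
  by (simp add: L_max_def)

lemma L_max_pos: "L_max > 0"
  using L_pos[OF block_size] L_le_L_max[OF block_size] by linarith

lemma finite_blocks: "finite blocks"
  by (rule finite_subset[of _ "Pow {1..m}"]) (auto simp: blocks_def)

lemma GDERIV_component: "i \<in> {1..m} \<Longrightarrow> GDERIV (f i) x :> grad (f i) x"
  using differentiable by (intro GDERIV_grad) (auto simp: differentiable_on_def)

lemma block_grad_inner: "block_grad \<tau> f S x \<bullet> d = (\<Sum>i\<in>S. 1 / real \<tau> * (grad (f i) x \<bullet> d))"
  by (simp add: block_grad_def inner_sum_left)

lemma block_val_above_gradient:
  assumes "S \<in> blocks"
  shows "block_val \<tau> f S x + block_grad \<tau> f S x \<bullet> (y - x) \<le> block_val \<tau> f S y"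
proof -
  have "(\<Sum>i\<in>S. 1 / real \<tau> * (f i x + grad (f i) x \<bullet> (y - x))) \<le> block_val \<tau> f S y"
    unfolding block_val_def using assms
    by (intro sum_mono mult_left_mono convex_on_above_gradient convex GDERIV_component)
       (auto simp: blocks_def)
  then show ?thesis
    by (simp add: block_val_def block_grad_inner distrib_left sum.distrib add_divide_distrib)
qed

lemma block_val_descent:
  assumes S: "S \<in> blocks"
  shows "block_val \<tau> f S y
    \<le> block_val \<tau> f S x + block_grad \<tau> f S x \<bullet> (y - x) + L_max / 2 * (norm (y - x))\<^sup>2"
proof -
  let ?q = "L_max / 2 * (norm (y - x))\<^sup>2"
  have "f i y \<le> f i x + grad (f i) x \<bullet> (y - x) + ?q" if "i \<in> S" for i
  proof -
    have i: "i \<in> {1..m}"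
      using that S by (auto simp: blocks_def)
    have "L i / 2 * (norm (y - x))\<^sup>2 \<le> ?q"
      using L_le_L_max[OF i] by (intro mult_right_mono) auto
    then show ?thesis
      using descent_lemma[OF GDERIV_component lipschitz, OF i i, of y x] by simp
  qed
  then have "block_val \<tau> f S y
      \<le> (\<Sum>i\<in>S. 1 / real \<tau> * (f i x + grad (f i) x \<bullet> (y - x) + ?q))"
    unfolding block_val_def by (intro sum_mono mult_left_mono) auto
  also have "\<dots> = block_val \<tau> f S x + block_grad \<tau> f S x \<bullet> (y - x)
      + (\<Sum>i\<in>S. 1 / real \<tau> * ?q)"
    by (simp only: block_val_def block_grad_inner distrib_left sum.distrib)
  \<comment> \<open>A block has \<open>\<tau>\<close> indices of weight \<open>1 / \<tau>\<close>,
    so the constant \<open>?q\<close> averages to itself.\<close>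
  also have "(\<Sum>i\<in>S. 1 / real \<tau> * ?q) = ?q"
    using S block_size by (simp add: blocks_def)
  finally show ?thesis .
qed

text \<open>The descent lemma at the gradient step \<open>x - g / L_max\<close>.\<close>

lemma block_grad_norm_sq_le:
  assumes S: "S \<in> blocks" and l: "\<And>y. l \<le> block_val \<tau> f S y"
  shows "(norm (block_grad \<tau> f S x))\<^sup>2 \<le> 2 * L_max * (block_val \<tau> f S x - l)"
proof -
  let ?g = "block_grad \<tau> f S x"
  have "l \<le> block_val \<tau> f S x - (norm ?g)\<^sup>2 / (2 * L_max)"
    using order_trans[OF l block_val_descent[OF S, of "x - (1 / L_max) *\<^sub>R ?g" x]] L_max_pos
    by (simp add: power2_norm_eq_inner[symmetric] power_divide power2_eq_square field_simps)
  then show ?thesis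
    using L_max_pos by (simp add: field_simps)
qed

end

section \<open>Bounds on the stepsize ratio\<close>

text \<open>The ratio of stepsize to \<lambda> at one iteration, with \<open>r\<close> the preceding
  ratio. As a function of block, point and \<open>r\<close> it can be studied without a
  trajectory.\<close>

definition capped_polyak ::
  "real \<Rightarrow> (nat \<Rightarrow> 'a::real_inner \<Rightarrow> real) \<Rightarrow> nat \<Rightarrow> (nat set \<Rightarrow> real) \<Rightarrow> nat set \<Rightarrow> 'a \<Rightarrow> real \<Rightarrow> real"
  where
  "capped_polyak \<mu> f \<tau> l S x r =
     (if (norm (block_grad \<tau> f S x))\<^sup>2 = 0 then r
      else min (\<mu> * ((block_val \<tau> f S x - l S) / (norm (block_grad \<tau> f S x))\<^sup>2)) r)"

lemma capped_polyak_le: "capped_polyak \<mu> f \<tau> l S x r \<le> r"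
  by (simp add: capped_polyak_def)

text \<open>This is the first entry of the minimum, multiplied out. When the block gradient
  vanishes, the left side is 0 and the gap on the right is nonnegative.\<close>

lemma capped_polyak_times_norm_le:
  assumes "\<mu> \<ge> 0" and "l S \<le> block_val \<tau> f S x"
  shows "capped_polyak \<mu> f \<tau> l S x r * (norm (block_grad \<tau> f S x))\<^sup>2
    \<le> \<mu> * (block_val \<tau> f S x - l S)"
proof (cases "block_grad \<tau> f S x = 0")
  case False
  have "capped_polyak \<mu> f \<tau> l S x r * (norm (block_grad \<tau> f S x))\<^sup>2
      \<le> \<mu> * ((block_val \<tau> f S x - l S) / (norm (block_grad \<tau> f S x))\<^sup>2)
          * (norm (block_grad \<tau> f S x))\<^sup>2"
    using False by (intro mult_right_mono) (auto simp: capped_polyak_def)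
  then show ?thesis
    using False by simp
qed (use assms in simp)

text \<open>Smoothness bounds the squared block gradient by \<open>2 * L_max\<close> times the gap,
  which keeps the Polyak ratio at least \<open>\<mu> / (2 * L_max)\<close>.\<close>

lemma (in smooth_blocks) capped_polyak_ge:
  assumes "\<mu> > 0" and S: "S \<in> blocks" and l: "\<And>y. l S \<le> block_val \<tau> f S y"
    and "a \<le> r" and a: "a \<le> \<mu> / (2 * L_max)"
  shows "a \<le> capped_polyak \<mu> f \<tau> l S x r"
proof (cases "block_grad \<tau> f S x = 0")
  case False
  have "1 / (2 * L_max) \<le> (block_val \<tau> f S x - l S) / (norm (block_grad \<tau> f S x))\<^sup>2"
    using block_grad_norm_sq_le[OF S l, of x] False L_max_pos by (simp add: field_simps)
  from mult_left_mono[OF this, of \<mu>]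
  have "\<mu> / (2 * L_max) \<le> \<mu> * ((block_val \<tau> f S x - l S) / (norm (block_grad \<tau> f S x))\<^sup>2)"
    using \<open>\<mu> > 0\<close> by simp
  then show ?thesis
    using assms by (simp add: capped_polyak_def)
qed (use assms in \<open>simp add: capped_polyak_def\<close>)

lemma decmsps_stepsize:
  assumes "decmsps \<mu> f \<tau> l lam \<gamma>\<^sub>b Js xs ts"
  shows "ts k = lam k * capped_polyak \<mu> f \<tau> l (Js k) (xs k) (prev_ratio lam \<gamma>\<^sub>b ts k)"
  using assms unfolding decmsps_def capped_polyak_def by blast

text \<open>Dividing the stepsize rule by \<open>lam k\<close> turns it into a recursion for the
  ratios, from which both bounds below follow by induction.\<close>

lemma prev_ratio_Suc:
  assumes "decmsps \<mu> f \<tau> l lam \<gamma>\<^sub>b Js xs ts" and "\<And>j. 0 < lam j"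
  shows "prev_ratio lam \<gamma>\<^sub>b ts (Suc k)
    = capped_polyak \<mu> f \<tau> l (Js k) (xs k) (prev_ratio lam \<gamma>\<^sub>b ts k)"
  unfolding prev_ratio_def[of _ _ _ "Suc k"]
  using decmsps_stepsize[OF assms(1), of k] assms(2)[of k] by simp

lemma prev_ratio_le:
  assumes "decmsps \<mu> f \<tau> l lam \<gamma>\<^sub>b Js xs ts" and "\<And>j. 0 < lam j"
  shows "prev_ratio lam \<gamma>\<^sub>b ts k \<le> \<gamma>\<^sub>b / lam 0"
proof (induction k)
  case (Suc k)
  then show ?case
    unfolding prev_ratio_Suc[OF assms] using capped_polyak_le order_trans by metis
qed (simp add: prev_ratio_def)

text \<open>The bound is an invariant: the ratio starts at \<open>\<gamma>\<^sub>b / lam 0\<close>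
  and is only ever capped by Polyak ratios of at least \<open>\<mu> / (2 * L_max)\<close>.\<close>

lemma (in smooth_blocks) prev_ratio_ge:
  assumes d: "decmsps \<mu> f \<tau> l lam \<gamma>\<^sub>b Js xs ts" "\<And>j. 0 < lam j" and "\<mu> > 0"
    and "\<And>j. j < k \<Longrightarrow> Js j \<in> blocks" and "\<And>j y. j < k \<Longrightarrow> l (Js j) \<le> block_val \<tau> f (Js j) y"
  shows "min (\<mu> / (2 * L_max)) (\<gamma>\<^sub>b / lam 0) \<le> prev_ratio lam \<gamma>\<^sub>b ts k"
  using assms(4-)
proof (induction k)
  case (Suc k)
  then show ?case
    unfolding prev_ratio_Suc[OF d] using \<open>\<mu> > 0\<close> by (intro capped_polyak_ge) auto
qed (simp add: prev_ratio_def)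

section \<open>The trajectory and one step of the method\<close>

text \<open>Ratio, primal and dual iterate together form a state whose successor is fixed by the
  state and the current block. Hence the state at time \<open>k\<close> is a function of the blocks
  before \<open>k\<close>.\<close>

lemma sbbp_decmsps_determined:
  assumes "sbbp \<psi> f \<tau> x0 s0 Js ts xs ss" "decmsps \<mu> f \<tau> l lam \<gamma>\<^sub>b Js xs ts"
    and "sbbp \<psi> f \<tau> x0 s0 Js' ts' xs' ss'" "decmsps \<mu> f \<tau> l lam \<gamma>\<^sub>b Js' xs' ts'"
    and "\<And>j. 0 < lam j" and "\<And>j. j < k \<Longrightarrow> Js j = Js' j"
  shows "prev_ratio lam \<gamma>\<^sub>b ts k = prev_ratio lam \<gamma>\<^sub>b ts' k \<and> xs k = xs' k \<and> ss k = ss' k"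
  using assms(6)
proof (induction k)
  case 0
  then show ?case
    using assms(1,3) by (simp add: sbbp_def prev_ratio_def)
next
  case (Suc k)
  then have IH: "prev_ratio lam \<gamma>\<^sub>b ts k = prev_ratio lam \<gamma>\<^sub>b ts' k" "xs k = xs' k" "ss k = ss' k"
    and J: "Js k = Js' k"
    by auto
  have t: "ts k = ts' k"
    using decmsps_stepsize[OF assms(2), of k] decmsps_stepsize[OF assms(4), of k] IH J by simp
  have "ss (Suc k) = ss' (Suc k)"
    using assms(1,3) IH J t by (simp add: sbbp_def)
  moreover from this have "xs (Suc k) = xs' (Suc k)"
    using assms(1,3) by (simp add: sbbp_def)
  moreover have "prev_ratio lam \<gamma>\<^sub>b ts (Suc k) = prev_ratio lam \<gamma>\<^sub>b ts' (Suc k)"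
    using t by (simp add: prev_ratio_def)
  ultimately show ?case
    by simp
qed

lemma sbbp_subdifferential:
  fixes \<psi> :: "'a::euclidean_space \<Rightarrow> real"
  assumes "\<mu> > 0" and "strongly_convex \<mu> \<psi>" and sbbp: "sbbp \<psi> f \<tau> x0 s0 Js ts xs ss"
  shows "ss k \<in> subdifferential \<psi> (xs k)"
proof (cases k)
  case (Suc j)
  have "s0 \<in> subdifferential \<psi> x0"
    using sbbp by (simp add: sbbp_def)
  then show ?thesis
    using grad_fenchel_conjugate_subdifferential[OF assms(1,2)] sbbp Suc by (simp add: sbbp_def)
qed (use sbbp in \<open>simp add: sbbp_def\<close>)

text \<open>Convexity bounds the inner product below by the difference of the gaps at
  \<open>x\<close> and \<open>z\<close>, and the Polyak cap bounds the quadratic term by a multiple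
  of the gap at \<open>x\<close>.\<close>

lemma (in smooth_blocks) bregman_polyak_step:
  assumes "\<mu> > 0" and sc: "strongly_convex \<mu> \<psi>" and s: "s \<in> subdifferential \<psi> x"
    and S: "S \<in> blocks" and l: "\<And>y. l S \<le> block_val \<tau> f S y"
    and \<rho>: "\<rho> = capped_polyak \<mu> f \<tau> l S x r"
    and a: "0 \<le> a" "a \<le> r" "a \<le> \<mu> / (2 * L_max)" and b: "r \<le> b"
    and \<eta>: "0 < \<eta>" "\<eta> < 2"
  shows "bregman \<psi> (s - (\<eta> * \<rho>) *\<^sub>R block_grad \<tau> f S x) x' z
    \<le> bregman \<psi> s x z - \<eta> * (1 - \<eta> / 2) * a * (block_val \<tau> f S x - l S)
        + \<eta> * b * (block_val \<tau> f S z - l S)"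
proof -
  let ?g = "block_grad \<tau> f S x" and ?hx = "block_val \<tau> f S x - l S" and ?hz = "block_val \<tau> f S z - l S"
  have \<rho>_ge: "a \<le> \<rho>"
    unfolding \<rho> using \<open>\<mu> > 0\<close> S l a(2,3) by (rule capped_polyak_ge)
  have \<rho>_le: "\<rho> \<le> b"
    using capped_polyak_le[of \<mu> f \<tau> l S x r] b by (simp add: \<rho>)
  have "(\<eta> * \<rho>) * (?hx - ?hz) \<le> (\<eta> * \<rho>) * (?g \<bullet> (x - z))"
    using block_val_above_gradient[OF S, of x z] \<eta> \<rho>_ge a(1)
    by (intro mult_left_mono) (auto simp: inner_diff_right)
  moreover have "(\<eta> * \<rho>)\<^sup>2 * (norm ?g)\<^sup>2 / (2 * \<mu>) \<le> \<eta>\<^sup>2 * \<rho> / 2 * ?hx"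
  proof -
    have "\<rho> * (norm ?g)\<^sup>2 \<le> \<mu> * ?hx"
      unfolding \<rho> using \<open>\<mu> > 0\<close> l by (intro capped_polyak_times_norm_le) auto
    then have "(\<eta>\<^sup>2 * \<rho> / (2 * \<mu>)) * (\<rho> * (norm ?g)\<^sup>2) \<le> (\<eta>\<^sup>2 * \<rho> / (2 * \<mu>)) * (\<mu> * ?hx)"
      using \<rho>_ge a(1) \<open>\<mu> > 0\<close> by (intro mult_left_mono) auto
    then show ?thesis
      using \<open>\<mu> > 0\<close> by (simp add: power2_eq_square ac_simps)
  qed
  ultimately have "bregman \<psi> (s - (\<eta> * \<rho>) *\<^sub>R ?g) x' z
      \<le> bregman \<psi> s x z - (\<eta> * \<rho>) * (?hx - ?hz) + \<eta>\<^sup>2 * \<rho> / 2 * ?hx"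
    using bregman_mirror_step[OF \<open>\<mu> > 0\<close> sc s, of "\<eta> * \<rho>" ?g x' z] by linarith
  also have "\<dots> = bregman \<psi> s x z - \<eta> * (1 - \<eta> / 2) * \<rho> * ?hx + \<eta> * \<rho> * ?hz"
    by (simp add: power2_eq_square algebra_simps)
  \<comment> \<open>The ratio \<rho> depends on the block. As both gaps are nonnegative, it can be
    replaced by the constants \<open>a\<close> and \<open>b\<close>, which leaves a bound linear in
    the block values and ready to be averaged.\<close>
  also have "\<dots> \<le> bregman \<psi> s x z - \<eta> * (1 - \<eta> / 2) * a * ?hx + \<eta> * b * ?hz"
  proof -
    have "\<eta> * (1 - \<eta> / 2) * a * ?hx \<le> \<eta> * (1 - \<eta> / 2) * \<rho> * ?hx"
      using \<eta> \<rho>_ge l by (intro mult_right_mono mult_left_mono) auto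
    moreover have "\<eta> * \<rho> * ?hz \<le> \<eta> * b * ?hz"
      using \<eta> \<rho>_le l by (intro mult_right_mono mult_left_mono) auto
    ultimately show ?thesis
      by linarith
  qed
  finally show ?thesis .
qed

section \<open>The expected decrease from a fixed state\<close>

lemma argmin_set_eq: "z \<in> argmin_set F \<Longrightarrow> F z = min_value F"
  for F :: "'a \<Rightarrow> real"
  unfolding min_value_def argmin_set_def is_arg_min_linorder
  by (intro cInf_eq_minimum[symmetric]) auto

context smooth_blocks
begin

text \<open>Written with indicators over all indices, the inclusion probability
  \<open>\<tau> / m\<close> cancels the weight \<open>1 / \<tau>\<close> and leaves
  \<open>1 / m\<close>.\<close>

lemma expectation_block_val:
  assumes supp: "set_pmf D \<subseteq> blocks"
    and D: "\<And>i. i \<in> {1..m} \<Longrightarrow> measure_pmf.prob D {S. i \<in> S} = real \<tau> / real m"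
  shows "measure_pmf.expectation D (\<lambda>S. block_val \<tau> f S y) = finite_avg m f y"
proof -
  have "measure_pmf.expectation D (\<lambda>S. block_val \<tau> f S y)
      = measure_pmf.expectation D (\<lambda>S. \<Sum>i\<in>{1..m}. 1 / real \<tau> * f i y * indicator {S. i \<in> S} S)"
  proof (rule integral_cong_AE)
    show "AE S in measure_pmf D. block_val \<tau> f S y
        = (\<Sum>i\<in>{1..m}. 1 / real \<tau> * f i y * indicator {S. i \<in> S} S)"
    proof (rule AE_pmfI)
      fix S assume "S \<in> set_pmf D"
      then have "S \<subseteq> {1..m}"
        using supp by (auto simp: blocks_def)
      then show "block_val \<tau> f S y = (\<Sum>i\<in>{1..m}. 1 / real \<tau> * f i y * indicator {S. i \<in> S} S)"
        unfolding block_val_def by (intro sum.mono_neutral_cong_left) auto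
    qed
  qed auto
  also have "\<dots> = (\<Sum>i\<in>{1..m}. 1 / real \<tau> * f i y * measure_pmf.prob D {S. i \<in> S})"
    by (subst Bochner_Integration.integral_sum) (auto simp: measure_pmf.emeasure_eq_measure)
  also have "\<dots> = (\<Sum>i\<in>{1..m}. 1 / real m * f i y)"
    using block_size by (intro sum.cong) (auto simp: D)
  finally show ?thesis
    unfolding finite_avg_def sum_distrib_left .
qed

lemma expected_dist_polyak_step:
  fixes \<psi> :: "'a \<Rightarrow> real"
  defines "X \<equiv> argmin_set (finite_avg m f)"
  assumes "\<mu> > 0" and sc: "strongly_convex \<mu> \<psi>" and s: "s \<in> subdifferential \<psi> x"
    and growth: "bregman_growth \<psi> (finite_avg m f) \<gamma>" and xhat: "xhat \<in> X"
    and supp: "set_pmf D \<subseteq> blocks"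
    and D: "\<And>i. i \<in> {1..m} \<Longrightarrow> measure_pmf.prob D {S. i \<in> S} = real \<tau> / real m"
    and l: "\<And>S y. S \<in> set_pmf D \<Longrightarrow> l S \<le> block_val \<tau> f S y"
    and a: "0 \<le> a" "a \<le> r" "a \<le> \<mu> / (2 * L_max)" and b: "r \<le> b"
    and \<eta>: "0 < \<eta>" "\<eta> < 2"
    and s': "\<And>S. s' S = s - (\<eta> * capped_polyak \<mu> f \<tau> l S x r) *\<^sub>R block_grad \<tau> f S x"
  shows "measure_pmf.expectation D
      (\<lambda>S. bregman_dist_sq \<psi> (s' S) (grad (fenchel_conjugate \<psi>) (s' S)) X)
    \<le> (1 - \<eta> * (1 - \<eta> / 2) * \<gamma> * a) * bregman_dist_sq \<psi> s x X + \<eta> * b * noise_const \<tau> f l D xhat"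
    (is "?E \<le> _")
proof -
  let ?F = "finite_avg m f" and ?c = "\<eta> * (1 - \<eta> / 2) * a" and ?El = "measure_pmf.expectation D l"
  have "finite (set_pmf D)"
    using supp finite_blocks by (rule finite_subset)
  note int [simp] = integrable_measure_pmf_finite[OF this]
  have E_block: "measure_pmf.expectation D (\<lambda>S. block_val \<tau> f S y) = ?F y" for y
    using supp D by (rule expectation_block_val)
  then have E_gap: "measure_pmf.expectation D (\<lambda>S. block_val \<tau> f S y - l S) = ?F y - ?El" for y
    by simp
  have "?El \<le> measure_pmf.expectation D (\<lambda>S. block_val \<tau> f S xhat)"
    by (intro integral_mono_AE AE_pmfI l) auto
  then have El_le: "?El \<le> min_value ?F"
    using xhat by (simp add: E_block argmin_set_eq X_def)
  \<comment> \<open>The minimiser \<open>z\<close> is fixed before averaging: for each block the new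
    distance is at most the Bregman distance to this same \<open>z\<close>.\<close>
  have step: "?E \<le> bregman \<psi> s x z - ?c * (?F x - ?El) + \<eta> * b * (min_value ?F - ?El)" if z: "z \<in> X" for z
  proof -
    have "?E \<le> measure_pmf.expectation D (\<lambda>S. bregman \<psi> s x z
        - ?c * (block_val \<tau> f S x - l S) + \<eta> * b * (block_val \<tau> f S z - l S))"
    proof (intro integral_mono_AE AE_pmfI)
      fix S assume S: "S \<in> set_pmf D"
      have "bregman_dist_sq \<psi> (s' S) (grad (fenchel_conjugate \<psi>) (s' S)) X
          \<le> bregman \<psi> (s' S) (grad (fenchel_conjugate \<psi>) (s' S)) z"
        using grad_fenchel_conjugate_subdifferential[OF \<open>\<mu> > 0\<close> sc s] z
        by (rule bregman_dist_sq_le)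
      also have "\<dots> \<le> bregman \<psi> s x z - ?c * (block_val \<tau> f S x - l S)
          + \<eta> * b * (block_val \<tau> f S z - l S)"
        unfolding s' by (rule bregman_polyak_step[where l = l, OF \<open>\<mu> > 0\<close> sc s _ _ refl a b \<eta>])
          (use S supp l in auto)
      finally show "bregman_dist_sq \<psi> (s' S) (grad (fenchel_conjugate \<psi>) (s' S)) X \<le> \<dots>" .
    qed auto
    also have "\<dots> = bregman \<psi> s x z - ?c * (?F x - ?El) + \<eta> * b * (?F z - ?El)"
      by (simp add: E_gap)
    also have "?F z = min_value ?F"
      using z unfolding X_def by (rule argmin_set_eq)
    finally show ?thesis .
  qed
  \<comment> \<open>All minimisers share the value \<open>min_value ?F\<close>, so only the Bregman
    distance depends on \<open>z\<close> and the infimum can be taken there alone.\<close>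
  have "?E + ?c * (?F x - ?El) - \<eta> * b * (min_value ?F - ?El) \<le> bregman_dist_sq \<psi> s x X"
    unfolding bregman_dist_sq_def[of \<psi> s x X]
  proof (rule cINF_greatest)
    fix z assume "z \<in> X"
    from step[OF this] show "?E + ?c * (?F x - ?El) - \<eta> * b * (min_value ?F - ?El) \<le> bregman \<psi> s x z"
      by linarith
  qed (use xhat in blast)
  \<comment> \<open>Growth controls \<open>?F x - min_value ?F\<close>, which is at most
    \<open>?F x - ?El\<close> because the expected lower bound lies below the minimum.\<close>
  moreover have "?c * (\<gamma> * bregman_dist_sq \<psi> s x X) \<le> ?c * (?F x - ?El)"
  proof (rule mult_left_mono)
    have "\<gamma> * bregman_dist_sq \<psi> s x X \<le> ?F x - min_value ?F"
      using growth s unfolding bregman_growth_def bregman_dist_sq_def X_def by blast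
    then show "\<gamma> * bregman_dist_sq \<psi> s x X \<le> ?F x - ?El"
      using El_le by linarith
  qed (use \<eta> a in auto)
  moreover have "noise_const \<tau> f l D xhat = min_value ?F - ?El"
    using xhat by (simp only: noise_const_def E_gap argmin_set_eq X_def)
  moreover have "(1 - \<eta> * (1 - \<eta> / 2) * \<gamma> * a) * bregman_dist_sq \<psi> s x X
      = bregman_dist_sq \<psi> s x X - ?c * (\<gamma> * bregman_dist_sq \<psi> s x X)"
    by (simp add: algebra_simps)
  ultimately show ?thesis
    by simp
qed

end

theorem theorem3:
  fixes \<psi> :: "real ^ 'n \<Rightarrow> real"
    and f :: "nat \<Rightarrow> real ^ 'n \<Rightarrow> real"
    and L :: "nat \<Rightarrow> real"
    and l :: "nat set \<Rightarrow> real"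
    and lam :: "nat \<Rightarrow> real"
    and \<mu> \<gamma> \<gamma>\<^sub>b :: real
    and m \<tau> :: nat
    and M :: "'w measure"
    and D :: "nat set pmf"
    and J :: "nat \<Rightarrow> 'w \<Rightarrow> nat set"
    and x0 s0 xhat :: "real ^ 'n"
    and x xstar :: "nat \<Rightarrow> 'w \<Rightarrow> real ^ 'n"
    and t :: "nat \<Rightarrow> 'w \<Rightarrow> real"
    and k :: nat
  assumes "\<mu> > 0" and "strongly_convex \<mu> \<psi>"
    and "\<And>i. i \<in> {1..m} \<Longrightarrow> convex_on UNIV (f i)"
    and "\<And>i. i \<in> {1..m} \<Longrightarrow> f i differentiable_on UNIV"
    and "\<And>i. i \<in> {1..m} \<Longrightarrow> L i > 0"
    and "\<And>i. i \<in> {1..m} \<Longrightarrow> (L i)-lipschitz_on UNIV (grad (f i))"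
    and "argmin_set (finite_avg m f) \<noteq> {}"
    and "\<gamma> > 0" and "bregman_growth \<psi> (finite_avg m f) \<gamma>"
    and "\<tau> \<in> {1..m}" and "block_sampling M m \<tau> D J"
    and "\<And>S. S \<in> set_pmf D \<Longrightarrow> ereal (l S) \<le> (INF y. ereal (block_val \<tau> f S y))"
    and "decseq lam" and "\<And>j. 0 < lam j" and "\<And>j. lam j < 2"
    and "\<gamma>\<^sub>b > 0"
    and "\<And>\<omega>. \<omega> \<in> space M \<Longrightarrow>
           sbbp \<psi> f \<tau> x0 s0 (\<lambda>j. J j \<omega>) (\<lambda>j. t j \<omega>) (\<lambda>j. x j \<omega>) (\<lambda>j. xstar j \<omega>)"
    and "\<And>\<omega>. \<omega> \<in> space M \<Longrightarrow>
           decmsps \<mu> f \<tau> l lam \<gamma>\<^sub>b (\<lambda>j. J j \<omega>) (\<lambda>j. x j \<omega>) (\<lambda>j. t j \<omega>)"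
    and "xhat \<in> argmin_set (finite_avg m f)"
  shows "prob_space.expectation M
           (\<lambda>\<omega>. bregman_dist_sq \<psi> (xstar (Suc k) \<omega>) (x (Suc k) \<omega>) (argmin_set (finite_avg m f)))
         \<le> (1 - lam k * (1 - lam k / 2) * \<gamma>
                 * min (\<mu> / (2 * Max (L ` {1..m}))) (\<gamma>\<^sub>b / lam 0))
             * prob_space.expectation M
                 (\<lambda>\<omega>. bregman_dist_sq \<psi> (xstar k \<omega>) (x k \<omega>) (argmin_set (finite_avg m f)))
           + lam k * (\<gamma>\<^sub>b / lam 0) * noise_const \<tau> f l D xhat"
proof -
  let ?X = "argmin_set (finite_avg m f)" and ?a = "min (\<mu> / (2 * Max (L ` {1..m}))) (\<gamma>\<^sub>b / lam 0)"
  interpret smooth_blocks f L m \<tau>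
    by unfold_locales (use assms(3-6,10) in auto)
  interpret prob_space M
    using assms(11) by (simp add: block_sampling_def)
  have J_blocks: "J j \<omega> \<in> blocks" if "\<omega> \<in> space M" for j \<omega>
    using assms(11) that by (simp add: block_sampling_def blocks_def)
  have indep: "indep_vars (\<lambda>_. count_space UNIV) J UNIV"
    and law: "distr M (count_space UNIV) (J j) = measure_pmf D"
    and incl: "i \<in> {1..m} \<Longrightarrow> measure_pmf.prob D {S. i \<in> S} = real \<tau> / real m" for i j
    using assms(11) by (auto simp: block_sampling_def)
  have rv [measurable]: "J j \<in> measurable M (count_space UNIV)" for j
    using indep by (simp add: indep_vars_def2)
  \<comment> \<open>This transfers almost sure statements between a block and its law
    \<open>D\<close>, in both directions.\<close>
  have AE_law: "(AE \<omega> in M. P (J j \<omega>)) \<longleftrightarrow> (AE S in measure_pmf D. P S)" for P j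
    using AE_distr_iff[OF rv[of j], of P] unfolding law by simp
  have supp: "set_pmf D \<subseteq> blocks"
  proof -
    have "AE \<omega> in M. J 0 \<omega> \<in> blocks"
      using J_blocks by (intro AE_I2)
    then show ?thesis
      unfolding AE_law[of "\<lambda>S. S \<in> blocks" 0] by (auto simp: AE_measure_pmf_iff)
  qed
  have l: "l S \<le> block_val \<tau> f S y" if "S \<in> set_pmf D" for S y
    using order_trans[OF assms(12)[OF that] INF_lower[of y]] by simp
  note sbbp = assms(17) and decmsps = assms(18)

  \<comment> \<open>The ratio belongs to the state because the next stepsize is capped by it; the
    two iterates alone do not determine the next step.\<close>
  define state where "state \<omega> = (prev_ratio lam \<gamma>\<^sub>b (\<lambda>j. t j \<omega>) k, x k \<omega>, xstar k \<omega>)" for \<omega>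
  define s' where
    "s' = (\<lambda>(r, y, s) S. s - (lam k * capped_polyak \<mu> f \<tau> l S y r) *\<^sub>R block_grad \<tau> f S y)"
  define next_dist where
    "next_dist p S = bregman_dist_sq \<psi> (s' p S) (grad (fenchel_conjugate \<psi>) (s' p S)) ?X" for p S
  have next_eq: "bregman_dist_sq \<psi> (xstar (Suc k) \<omega>) (x (Suc k) \<omega>) ?X = next_dist (state \<omega>) (J k \<omega>)"
    if "\<omega> \<in> space M" for \<omega>
    using sbbp[OF that] decmsps_stepsize[OF decmsps[OF that], of k]
    by (simp add: sbbp_def next_dist_def s'_def state_def)
  have past: "state \<omega> = state \<omega>'"
    if "\<omega> \<in> space M" "\<omega>' \<in> space M" "\<And>j. j < k \<Longrightarrow> J j \<omega> = J j \<omega>'" for \<omega> \<omega>'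
    using sbbp_decmsps_determined[OF sbbp[OF that(1)] decmsps[OF that(1)] sbbp[OF that(2)]
        decmsps[OF that(2)] assms(14) that(3)]
    by (simp add: state_def)
  have indep_state: "prob (state -` A \<inter> space M \<inter> (J k -` B \<inter> space M))
      = prob (state -` A \<inter> space M) * prob (J k -` B \<inter> space M)" for A B
    using indep finite_blocks J_blocks past by (rule prob_past_block)
  have rv_state: "state \<in> measurable M (count_space UNIV)"
    using indep finite_blocks J_blocks past by (rule measurable_past)
  have fin_state: "finite (state ` space M)"
    using indep finite_blocks J_blocks past by (rule finite_range_past)
  have int: "integrable M (\<lambda>\<omega>. u (state \<omega>))" for u :: "_ \<Rightarrow> real"
    by (rule integrable_finite_range[OF rv_state fin_state])
  have int_dist: "integrable M (\<lambda>\<omega>. bregman_dist_sq \<psi> (xstar k \<omega>) (x k \<omega>) ?X)"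
    using int[of "\<lambda>(r, y, s). bregman_dist_sq \<psi> s y ?X"] by (simp add: state_def)

  have "expectation (\<lambda>\<omega>. bregman_dist_sq \<psi> (xstar (Suc k) \<omega>) (x (Suc k) \<omega>) ?X)
      = expectation (\<lambda>\<omega>. next_dist (state \<omega>) (J k \<omega>))"
    by (rule Bochner_Integration.integral_cong) (simp_all add: next_eq)
  also have "\<dots> = expectation (\<lambda>\<omega>. measure_pmf.expectation D (next_dist (state \<omega>)))"
    using rv_state rv indep_state fin_state _ law
    by (rule expectation_indep_pmf)
       (rule finite_subset[OF _ finite_blocks], use J_blocks in auto)
  also have "\<dots> \<le> expectation (\<lambda>\<omega>. (1 - lam k * (1 - lam k / 2) * \<gamma> * ?a)
      * bregman_dist_sq \<psi> (xstar k \<omega>) (x k \<omega>) ?X + lam k * (\<gamma>\<^sub>b / lam 0) * noise_const \<tau> f l D xhat)"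
  proof (rule integral_mono_AE)
    \<comment> \<open>The lower bound on block values is available only on the support of
      \<open>D\<close>. All blocks lie there almost surely, including the earlier ones, on which the
      lower bound for the ratio rests.\<close>
    have "AE \<omega> in M. \<forall>j. J j \<omega> \<in> set_pmf D"
      unfolding AE_all_countable using AE_law[of "\<lambda>S. S \<in> set_pmf D"] by (simp add: AE_measure_pmf)
    with AE_space show "AE \<omega> in M. measure_pmf.expectation D (next_dist (state \<omega>))
        \<le> (1 - lam k * (1 - lam k / 2) * \<gamma> * ?a) * bregman_dist_sq \<psi> (xstar k \<omega>) (x k \<omega>) ?X
          + lam k * (\<gamma>\<^sub>b / lam 0) * noise_const \<tau> f l D xhat"
    proof eventually_elim
      case (elim \<omega>)
      note \<omega> = elim(1)
      show ?case
        unfolding next_dist_def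
      proof (rule expected_dist_polyak_step)
        show "?a \<le> prev_ratio lam \<gamma>\<^sub>b (\<lambda>j. t j \<omega>) k"
          unfolding L_max_def[symmetric] using elim supp l assms(1)
          by (intro prev_ratio_ge[OF decmsps[OF \<omega>] assms(14)]) auto
        show "prev_ratio lam \<gamma>\<^sub>b (\<lambda>j. t j \<omega>) k \<le> \<gamma>\<^sub>b / lam 0"
          by (rule prev_ratio_le[OF decmsps[OF \<omega>] assms(14)])
        show "xstar k \<omega> \<in> subdifferential \<psi> (x k \<omega>)"
          by (rule sbbp_subdifferential[OF assms(1,2) sbbp[OF \<omega>]])
        show "0 \<le> ?a"
          using assms(1,14,16) L_max_pos by (auto simp: L_max_def less_imp_le)
        show "?a \<le> \<mu> / (2 * L_max)"
          by (simp add: L_max_def)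
      qed (use assms supp incl l in \<open>auto simp: s'_def state_def\<close>)
    qed
  qed (use int int_dist in auto)
  also have "\<dots> = (1 - lam k * (1 - lam k / 2) * \<gamma> * ?a)
        * expectation (\<lambda>\<omega>. bregman_dist_sq \<psi> (xstar k \<omega>) (x k \<omega>) ?X)
      + lam k * (\<gamma>\<^sub>b / lam 0) * noise_const \<tau> f l D xhat"
    using int_dist by (simp add: prob_space)
  finally show ?thesis .
qed

end
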